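(* Let $t_1,\ldots,t_4$ be four lines in general position in the (real or complex) projective plane. Let $\mathsf{I}$ and $\mathsf{J}$ be one pair of intersections of these lines. Let $\mathcal{X}$ and $\mathcal{R}$ be two distinct conics tangent to $t_1,\ldots,t_4$. Let $P$ and $Q$ be two distinct points on $\mathcal{R}$. Consider the four tangents $a,b,c,d$ through $P$ and $Q$ to the conic $\mathcal{X}$. Then there is a conic $\mathcal{C}$ tangent to $a,b,c,d$, passing through $\mathsf{I}$ and $\mathsf{J}$, and such that the tangents at $\mathsf{I}$ and $\mathsf{J}$ to $\mathcal{C}$ and the tangents at $P$ and $Q$ to $\mathcal{R}$ meet in a point.
   Context: Four lines in general position have six points of intersection, which naturally group into three pairs, each pair consisting of the intersection of two of the lines and the intersection of the remaining two lines; "one pair of intersections" means one of these three pairs. In this theorem $\mathsf{I}$ and $\mathsf{J}$ are not required to be in any special position (in particular they need not be the absolute circle points). Of the four tangents $a,b,c,d$ to $\mathcal{X}$, two pass through $P$ and two pass through $Q$.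
   Formalization: X and R are nondegenerate; C is shown nondegenerate unless the tangents to R at P and Q meet on the line IJ, where no nondegenerate C exists and C is instead a degenerate conic: the doubled line IJ with a dual form. *)

theory Defs
  imports "HOL-Analysis.Analysis"
begin

text \<open>
  Points and lines of the projective plane over a field are represented by nonzero vectors of
  homogeneous coordinates; two such vectors stand for the same point (line) iff they are
  proportional.
\<close>

definition proj_eq :: "'a::field^3 \<Rightarrow> 'a^3 \<Rightarrow> bool" where
  "proj_eq u v \<longleftrightarrow> (\<exists>k. k \<noteq> 0 \<and> u = k *s v)"

definition incident :: "'a::field^3 \<Rightarrow> 'a^3 \<Rightarrow> bool" where
  "incident p l \<longleftrightarrow> (\<Sum>i\<in>UNIV. p $ i * l $ i) = 0"

definition proj_concurrent :: "'a::field^3 \<Rightarrow> 'a^3 \<Rightarrow> 'a^3 \<Rightarrow> bool" where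
  "proj_concurrent l m n \<longleftrightarrow> (\<exists>p. p \<noteq> 0 \<and> incident p l \<and> incident p m \<and> incident p n)"

definition proj_collinear :: "'a::field^3 \<Rightarrow> 'a^3 \<Rightarrow> 'a^3 \<Rightarrow> bool" where
  "proj_collinear p q r \<longleftrightarrow> (\<exists>l. l \<noteq> 0 \<and> incident p l \<and> incident q l \<and> incident r l)"

text \<open>A zero vector, or two proportional ones, would make a triple concurrent, so this includes
  that the \<open>t i\<close> are lines and pairwise distinct.\<close>

definition four_lines_general_position :: "(nat \<Rightarrow> 'a::field^3) \<Rightarrow> bool" where
  "four_lines_general_position t \<longleftrightarrow>
     (\<forall>i\<in>{1..4}. \<forall>j\<in>{1..4}. \<forall>k\<in>{1..4}.
        i \<noteq> j \<and> j \<noteq> k \<and> i \<noteq> k \<longrightarrow> \<not> proj_concurrent (t i) (t j) (t k))"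

text \<open>The set equation forces the four indices to be distinct.\<close>

definition pair_of_intersections ::
    "(nat \<Rightarrow> 'a::field^3) \<Rightarrow> 'a^3 \<Rightarrow> 'a^3 \<Rightarrow> bool" where
  "pair_of_intersections t p q \<longleftrightarrow> p \<noteq> 0 \<and> q \<noteq> 0 \<and>
     (\<exists>i j k l. {i, j, k, l} = {1..4} \<and>
        incident p (t i) \<and> incident p (t j) \<and> incident q (t k) \<and> incident q (t l))"

text \<open>
  A conic is a primal/dual pair \<open>(A, B)\<close> of nonzero symmetric matrices with \<open>A B\<close> a scalar
  matrix: \<open>A\<close> is the quadratic form of its points, \<open>B\<close> the one of its tangent lines. If \<open>A\<close> is
  invertible, \<open>B\<close> is the inverse of \<open>A\<close> up to a factor, so a nondegenerate conic is just a
  nonsingular symmetric matrix up to a factor. The degenerate conics are two lines (\<open>B\<close> being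
  their intersection counted twice), a double line with two points on it (the common points of
  its tangents), possibly over a quadratic extension, and a double line with one double point.
\<close>

type_synonym 'a conic = "('a^3^3) \<times> ('a^3^3)"

definition is_conic :: "'a::field conic \<Rightarrow> bool" where
  "is_conic C \<longleftrightarrow> fst C \<noteq> 0 \<and> snd C \<noteq> 0 \<and>
     transpose (fst C) = fst C \<and> transpose (snd C) = snd C \<and>
     (\<exists>k. fst C ** snd C = mat k)"

definition nondegenerate_conic :: "'a::field conic \<Rightarrow> bool" where
  "nondegenerate_conic C \<longleftrightarrow> is_conic C \<and> det (fst C) \<noteq> 0"

text \<open>Only meant for nondegenerate conics, where the first component determines the conic.\<close>

definition same_conic :: "'a::field conic \<Rightarrow> 'a conic \<Rightarrow> bool" where
  "same_conic C D \<longleftrightarrow> (\<exists>k. k \<noteq> 0 \<and> (\<forall>i j. fst C $ i $ j = k * fst D $ i $ j))"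

definition on_conic :: "'a::field conic \<Rightarrow> 'a^3 \<Rightarrow> bool" where
  "on_conic C p \<longleftrightarrow> p \<noteq> 0 \<and> incident p (fst C *v p)"

text \<open>
  The line \<open>l\<close> is a tangent of \<open>C\<close> with point of contact \<open>p\<close>. For a nondegenerate conic this
  says that \<open>p\<close> is on \<open>C\<close> and \<open>l\<close> is its polar line \<open>A p\<close> (lemma
  \<open>tangent_at_nondegenerate_iff\<close>); the multiples may be zero in the degenerate cases.
\<close>

definition tangent_at :: "'a::field conic \<Rightarrow> 'a^3 \<Rightarrow> 'a^3 \<Rightarrow> bool" where
  "tangent_at C p l \<longleftrightarrow> p \<noteq> 0 \<and> l \<noteq> 0 \<and> incident p l \<and>
     (\<exists>k. fst C *v p = k *s l) \<and> (\<exists>k. snd C *v l = k *s p)"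

definition tangent_line :: "'a::field conic \<Rightarrow> 'a^3 \<Rightarrow> bool" where
  "tangent_line C l \<longleftrightarrow> (\<exists>p. tangent_at C p l)"

text \<open>\<open>a\<close> and \<open>b\<close> are the tangents of \<open>C\<close> through \<open>p\<close>; they coincide if \<open>p\<close> is on \<open>C\<close>.\<close>

definition tangents_through :: "'a::field conic \<Rightarrow> 'a^3 \<Rightarrow> 'a^3 \<Rightarrow> 'a^3 \<Rightarrow> bool" where
  "tangents_through C p a b \<longleftrightarrow> a \<noteq> 0 \<and> b \<noteq> 0 \<and>
     (\<forall>l. tangent_line C l \<and> incident p l \<longleftrightarrow> proj_eq l a \<or> proj_eq l b)"

lemma sym_form:
  fixes A :: "'a::field^3^3"
  assumes "transpose A = A"
  shows "(\<Sum>i\<in>UNIV. x $ i * (A *v y) $ i) = (\<Sum>i\<in>UNIV. (A *v x) $ i * y $ i)"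
proof -
  have s: "A $ i $ j = A $ j $ i" for i j
    using arg_cong[OF assms, of "\<lambda>B. B $ j $ i"] by (simp add: transpose_def)
  show ?thesis
    by (simp add: matrix_vector_mult_def sum_3 algebra_simps s[of 2 1] s[of 3 1] s[of 3 2])
qed

lemma mat_vec_scale: "mat k *v x = k *s (x :: 'a::field^3)"
  by (simp add: vec_eq_iff forall_3 matrix_vector_mult_def mat_def sum_3)

lemma conic_products:
  assumes "is_conic C"
  obtains k where "\<And>x. fst C *v (snd C *v x) = k *s x" "\<And>x. snd C *v (fst C *v x) = k *s x"
proof -
  from assms obtain k where k: "fst C ** snd C = mat k"
    and s: "transpose (fst C) = fst C" "transpose (snd C) = snd C"
    unfolding is_conic_def by blast
  have "snd C ** fst C = transpose (fst C ** snd C)"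
    by (simp add: matrix_transpose_mul s)
  also have "\<dots> = mat k" by (simp add: k)
  finally have k': "snd C ** fst C = mat k" .
  show ?thesis
    by (rule that[of k]) (simp_all add: matrix_vector_mul_assoc k k' mat_vec_scale)
qed

lemma tangent_at_nondegenerate_iff:
  fixes C :: "'a::field conic"
  assumes "nondegenerate_conic C"
  shows "tangent_at C p l \<longleftrightarrow> on_conic C p \<and> proj_eq l (fst C *v p)"
proof -
  have C: "is_conic C" and d: "det (fst C) \<noteq> 0"
    using assms by (auto simp: nondegenerate_conic_def)
  obtain k where k: "\<And>x. snd C *v (fst C *v x) = k *s x" using conic_products[OF C] by metis
  have nz: "fst C *v p \<noteq> 0" if "p \<noteq> 0"
    using that d by (metis invertible_det_nz invertible_def matrix_left_invertible_ker)
  show ?thesis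
  proof
    assume t: "tangent_at C p l"
    then obtain c where c: "fst C *v p = c *s l" and p: "p \<noteq> 0" and i: "incident p l"
      unfolding tangent_at_def by blast
    have "c \<noteq> 0" using nz[OF p] c by auto
    then have "l = inverse c *s (fst C *v p)" by (simp add: c)
    moreover have "incident p (fst C *v p)"
      using i unfolding incident_def c
      by (simp add: mult.left_commute flip: sum_distrib_left)
    ultimately show "on_conic C p \<and> proj_eq l (fst C *v p)"
      using p \<open>c \<noteq> 0\<close> unfolding on_conic_def proj_eq_def
      by (metis inverse_nonzero_iff_nonzero)
  next
    assume *: "on_conic C p \<and> proj_eq l (fst C *v p)"
    then obtain c where c: "c \<noteq> 0" "l = c *s (fst C *v p)" and p: "p \<noteq> 0"
      and i: "incident p (fst C *v p)"
      unfolding proj_eq_def on_conic_def by blast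
    have "fst C *v p = inverse c *s l" using c by simp
    moreover have "snd C *v l = (c * k) *s p"
      using k[of p] unfolding c by (simp add: vector_scalar_commute)
    moreover have "incident p l"
      using i unfolding incident_def c
      by (simp add: mult.left_commute flip: sum_distrib_left)
    moreover have "l \<noteq> 0" using c nz[OF p] by simp
    ultimately show "tangent_at C p l" using p unfolding tangent_at_def by blast
  qed
qed

text \<open>Every conic, degenerate or not, has a tangent at each of its points.\<close>

lemma tangent_at_exists:
  fixes C :: "'a::field conic"
  assumes C: "is_conic C" and p: "on_conic C p"
  shows "\<exists>l. tangent_at C p l"
proof -
  obtain k where k: "\<And>x. snd C *v (fst C *v x) = k *s x" using conic_products[OF C] by metis
  have p0: "p \<noteq> 0" and pi: "incident p (fst C *v p)" using p by (auto simp: on_conic_def)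
  show ?thesis
  proof (cases "fst C *v p = 0")
    case False
    have "tangent_at C p (fst C *v p)"
      unfolding tangent_at_def using False p0 pi k[of p] vector_smult_lid[of "fst C *v p"]
      by metis
    then show ?thesis ..
  next
    case True
    have "k *s p = 0" using k[of p] True by simp
    then have k0: "k = 0" using p0 by simp
    obtain x where x: "fst C *v x \<noteq> 0"
      using C unfolding is_conic_def by (metis matrix_eq matrix_vector_mult_0)
    have "incident p (fst C *v x)"
      using C True unfolding is_conic_def incident_def by (simp add: sym_form)
    moreover have "snd C *v (fst C *v x) = 0 *s p" using k[of x] k0 by simp
    moreover have "fst C *v p = 0 *s (fst C *v x)" using True by simp
    ultimately have "tangent_at C p (fst C *v x)"
      unfolding tangent_at_def using x p0 by blast
    then show ?thesis ..
  qed
qed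

end

theory Submission imports Defs begin

text \<open>
  Write \<open>u \<odot> v\<close> for the symmetric matrix \<open>u v\<^sup>T + v u\<^sup>T\<close>. The dual forms of conics tangent to
  \<open>t\<^sub>1, \<dots>, t\<^sub>4\<close> form a pencil containing \<open>I \<odot> J\<close>, so \<open>R\<^sup>* = s X\<^sup>* + \<mu> I \<odot> J\<close>. If \<open>M\<close> is the pole of
  \<open>PQ\<close> with respect to \<open>R\<close>, then also \<open>R\<^sup>* = \<beta> M \<odot> M + \<gamma> P \<odot> Q\<close>. Hence
  \<open>s X\<^sup>* - \<gamma> P \<odot> Q = \<beta> M \<odot> M - \<mu> I \<odot> J\<close>. The left-hand side shows that this dual conic is tangent
  to \<open>a, b, c, d\<close>, the right-hand side that it touches \<open>M I\<close> at \<open>I\<close> and \<open>M J\<close> at \<open>J\<close>.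
\<close>

section \<open>Dot and cross products of homogeneous coordinates\<close>

definition dot3 :: "'a::field^3 \<Rightarrow> 'a^3 \<Rightarrow> 'a" where
  "dot3 x y = (\<Sum>i\<in>UNIV. x $ i * y $ i)"

text \<open>The line joining two points or, dually, the point common to two lines.\<close>

definition cross :: "'a::field^3 \<Rightarrow> 'a^3 \<Rightarrow> 'a^3" where
  "cross x y = vector [x$2 * y$3 - x$3 * y$2, x$3 * y$1 - x$1 * y$3, x$1 * y$2 - x$2 * y$1]"

text \<open>As a dual form this is the pair of points \<open>x\<close>, \<open>y\<close>: its value
  at a line \<open>l\<close> is twice \<open>dot3 x l * dot3 y l\<close>, so its zeros are the lines
  through \<open>x\<close> or \<open>y\<close>.\<close>

definition sym_outer :: "'a::field^3 \<Rightarrow> 'a^3 \<Rightarrow> 'a^3^3" where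
  "sym_outer x y = (\<chi> i j. x $ i * y $ j + y $ i * x $ j)"

definition mscale :: "'a::field \<Rightarrow> 'a^3^3 \<Rightarrow> 'a^3^3" where
  "mscale k A = (\<chi> i j. k * A $ i $ j)"

lemma incident_dot3: "incident x y \<longleftrightarrow> dot3 x y = 0"
  by (simp add: incident_def dot3_def)

lemma dot3_commute: "dot3 x y = dot3 y x"
  by (simp add: dot3_def mult.commute)

lemma dot3_simps [simp]:
  "dot3 (x + y) z = dot3 x z + dot3 y z" "dot3 z (x + y) = dot3 z x + dot3 z y"
  "dot3 (x - y) z = dot3 x z - dot3 y z" "dot3 z (x - y) = dot3 z x - dot3 z y"
  "dot3 (k *s x) z = k * dot3 x z" "dot3 z (k *s x) = k * dot3 z x"
  "dot3 (- x) z = - dot3 x z" "dot3 z (- x) = - dot3 z x"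
  "dot3 0 z = 0" "dot3 z 0 = 0"
  by (simp_all add: dot3_def sum_3 algebra_simps)

lemma dot3_cross [simp]:
  "dot3 x (cross x y) = 0" "dot3 y (cross x y) = 0"
  "dot3 (cross x y) x = 0" "dot3 (cross x y) y = 0"
  by (simp_all add: dot3_def cross_def sum_3 algebra_simps)

lemma mscale_mv [simp]: "mscale k A *v x = k *s (A *v x)"
  by (simp add: mscale_def matrix_vector_mult_def vec_eq_iff sum_distrib_left mult.assoc)

lemma sym_outer_mv [simp]: "sym_outer x y *v z = dot3 y z *s x + dot3 x z *s y"
  by (simp add: sym_outer_def dot3_def matrix_vector_mult_def vec_eq_iff sum_3 algebra_simps)

lemma transpose_mscale [simp]: "transpose (mscale k A) = mscale k (transpose A)"
  by (simp add: transpose_def mscale_def)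

lemma transpose_sym_outer [simp]: "transpose (sym_outer x y) = sym_outer x y"
  by (simp add: transpose_def sym_outer_def vec_eq_iff mult.commute add.commute)

lemma transpose_diff: "transpose (A - B) = transpose A - transpose (B::'a::ab_group_add^'n^'m)"
  by (simp add: transpose_def vec_eq_iff)

lemma dot3_sym:
  assumes "transpose A = A"
  shows "dot3 x (A *v y) = dot3 y (A *v x)"
  using sym_form[OF assms, of x y] by (simp add: dot3_def mult.commute)

lemma proj_concurrent_dot3:
  "\<not> proj_concurrent x y z \<Longrightarrow> dot3 v x = 0 \<Longrightarrow> dot3 v y = 0 \<Longrightarrow> dot3 v z = 0 \<Longrightarrow> v = 0"
  unfolding proj_concurrent_def incident_dot3 by blast

lemma cross_eq_0:
  assumes "cross x y = 0" "x \<noteq> 0"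
  shows "\<exists>k. y = k *s x"
proof -
  obtain i where i: "x $ i \<noteq> 0" using assms(2) by (auto simp: vec_eq_iff)
  have "x $ i * y $ j = y $ i * x $ j" for i j
    using assms(1) exhaust_3[of i] exhaust_3[of j]
    by (auto simp: cross_def vec_eq_iff forall_3 algebra_simps)
  then have "y = (y $ i / x $ i) *s x" using i by (simp add: vec_eq_iff field_simps)
  then show ?thesis ..
qed

lemma nonproportional_of_line:
  assumes "dot3 p l = 0" "dot3 q l \<noteq> 0" "p \<noteq> 0"
  shows "cross p q \<noteq> 0"
  using cross_eq_0[of p q] assms by auto

lemma orthogonal_cross:
  assumes "cross x y \<noteq> 0" "dot3 x z = 0" "dot3 y z = 0"
  shows "\<exists>k. z = k *s cross x y"
proof (rule cross_eq_0)
  show "cross (cross x y) z = 0"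
  proof -
    have "cross (cross x y) z = dot3 x z *s y - dot3 y z *s x"
      by (simp add: cross_def dot3_def vec_eq_iff forall_3 sum_3 algebra_simps)
    then show ?thesis using assms by simp
  qed
qed (use assms in auto)

text \<open>Cramer's rule for the linear dependence of four vectors in dimension three: the
  coefficients are the determinants of the triples.\<close>

lemma cramer_relation:
  "dot3 y (cross z w) *s x - dot3 x (cross z w) *s y + dot3 x (cross y w) *s z
    = dot3 x (cross y z) *s w"
  by (simp add: cross_def dot3_def vec_eq_iff forall_3 sum_3 algebra_simps)

text \<open>Common points of the three lines are kernel vectors of the matrix with rows
  \<open>x\<close>, \<open>y\<close>, \<open>z\<close>, and the triple product is its
  determinant.\<close>

lemma proj_concurrent_iff: "proj_concurrent x y z \<longleftrightarrow> dot3 x (cross y z) = 0"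
proof -
  define N :: "'a^3^3" where "N = vector [x, y, z]"
  have "N *v v = 0 \<longleftrightarrow> dot3 v x = 0 \<and> dot3 v y = 0 \<and> dot3 v z = 0" for v
    by (simp add: N_def vec_eq_iff forall_3 matrix_vector_mult_def dot3_def mult.commute)
  then have "proj_concurrent x y z \<longleftrightarrow> \<not> (\<forall>v. N *v v = 0 \<longrightarrow> v = 0)"
    unfolding proj_concurrent_def incident_dot3 by auto
  also have "\<dots> \<longleftrightarrow> det N = 0"
    by (metis invertible_det_nz invertible_left_inverse matrix_left_invertible_ker)
  also have "det N = dot3 x (cross y z)"
    by (simp add: N_def det_3 dot3_def cross_def sum_3 algebra_simps)
  finally show ?thesis .
qed

section \<open>The pencil of dual conics tangent to four lines\<close>

text \<open>Nonconcurrent lines form a basis, and a symmetric bilinear form is determined by its six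
  values on a basis.\<close>

lemma symmetric_matrix_eq_0:
  assumes sym: "transpose T = T" and nc: "\<not> proj_concurrent x y z"
    and "dot3 x (T *v x) = 0" "dot3 y (T *v y) = 0" "dot3 z (T *v z) = 0"
    and "dot3 x (T *v y) = 0" "dot3 x (T *v z) = 0" "dot3 y (T *v z) = 0"
  shows "T = 0"
proof -
  have "T *v x = 0" "T *v y = 0" "T *v z = 0"
    using proj_concurrent_dot3[OF nc] assms dot3_sym[OF sym] dot3_commute by metis+
  then have "dot3 (T $ i) x = 0" "dot3 (T $ i) y = 0" "dot3 (T $ i) z = 0" for i
    by (simp_all add: vec_eq_iff matrix_vector_mult_def dot3_def)
  then have "T $ i = 0" for i by (rule proj_concurrent_dot3[OF nc])
  then show ?thesis by (simp add: vec_eq_iff)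
qed

text \<open>Subtracting a multiple of \<open>sym_outer I J\<close> leaves a form that vanishes on
  five of the six pairs from the basis \<open>x\<close>, \<open>y\<close>, \<open>z\<close>; its
  vanishing at the fourth line \<open>w\<close> forces the sixth.\<close>

lemma dual_form_point_pair:
  fixes T :: "'a::field_char_0^3^3"
  assumes sym: "transpose T = T"
    and nc: "\<not> proj_concurrent x y z" "\<not> proj_concurrent x y w" "\<not> proj_concurrent x z w"
    and nz: "dot3 I z \<noteq> 0" "dot3 J x \<noteq> 0"
    and I: "dot3 I x = 0" "dot3 I y = 0" and J: "dot3 J z = 0" "dot3 J w = 0"
    and T: "dot3 x (T *v x) = 0" "dot3 y (T *v y) = 0" "dot3 z (T *v z) = 0"
      "dot3 w (T *v w) = 0" "dot3 x (T *v y) = 0"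
  shows "\<exists>\<mu>. T = mscale \<mu> (sym_outer I J)"
proof -
  \<comment> \<open>Chosen to make \<open>dot3 x (F *v z)\<close> vanish;
    \<open>dot3 J z = 0\<close> leaves only one product from \<open>sym_outer I J\<close>.\<close>
  define \<mu> where "\<mu> = dot3 x (T *v z) / (dot3 J x * dot3 I z)"
  define F where "F = T - mscale \<mu> (sym_outer I J)"
  have Fmv: "F *v v = T *v v - \<mu> *s (dot3 J v *s I + dot3 I v *s J)" for v
    by (simp add: F_def matrix_vector_mult_diff_rdistrib)
  have symF: "transpose F = F"
    by (simp add: F_def transpose_diff sym)
  have F: "dot3 x (F *v x) = 0" "dot3 y (F *v y) = 0" "dot3 z (F *v z) = 0"
      "dot3 w (F *v w) = 0" "dot3 x (F *v y) = 0" "dot3 x (F *v z) = 0"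
    using T I J nz by (simp_all add: Fmv \<mu>_def dot3_commute[of _ I] dot3_commute[of _ J])
  define \<alpha> \<beta> \<gamma> \<delta> where "\<alpha> = dot3 y (cross z w)" and "\<beta> = dot3 x (cross z w)"
    and "\<gamma> = dot3 x (cross y w)" and "\<delta> = dot3 x (cross y z)"
  have rel: "\<delta> *s w = \<alpha> *s x - \<beta> *s y + \<gamma> *s z"
    using cramer_relation[of y z w x] by (simp add: \<alpha>_def \<beta>_def \<gamma>_def \<delta>_def)
  have nz': "\<beta> \<noteq> 0" "\<gamma> \<noteq> 0"
    using nc by (simp_all add: proj_concurrent_iff \<beta>_def \<gamma>_def)
  \<comment> \<open>Expanding the quadratic form at \<open>w\<close> in the basis leaves only the
    mixed term of \<open>y\<close> and \<open>z\<close>.\<close>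
  have "0 = dot3 (\<delta> *s w) (F *v (\<delta> *s w))"
    using F by (simp add: vector_scalar_commute)
  also have "\<dots> = - 2 * \<beta> * \<gamma> * dot3 y (F *v z)"
    using F unfolding rel
    by (simp add: matrix_vector_right_distrib matrix_vector_mult_diff_distrib
        vector_scalar_commute dot3_sym[OF symF, of y x] dot3_sym[OF symF, of z x]
        dot3_sym[OF symF, of z y])
  finally have "dot3 y (F *v z) = 0" using nz' by simp
  then have "F = 0" using symmetric_matrix_eq_0[OF symF nc(1)] F by simp
  then show ?thesis unfolding F_def by auto
qed

text \<open>A multiple of \<open>B\<close> can be subtracted from \<open>S\<close> so that the value
  on the pair \<open>x\<close>, \<open>y\<close> vanishes as well; the difference is then a multiple
  of the point pair \<open>I\<close>, \<open>J\<close>.\<close>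

lemma dual_pencil:
  fixes B S :: "'a::field_char_0^3^3"
  assumes sym: "transpose B = B" "transpose S = S"
    and nc: "\<not> proj_concurrent x y z" "\<not> proj_concurrent x y w" "\<not> proj_concurrent x z w"
    and nz: "dot3 I z \<noteq> 0" "dot3 J x \<noteq> 0"
    and I: "dot3 I x = 0" "dot3 I y = 0" and J: "dot3 J z = 0" "dot3 J w = 0"
    and B: "dot3 x (B *v x) = 0" "dot3 y (B *v y) = 0" "dot3 z (B *v z) = 0" "dot3 w (B *v w) = 0"
    and S: "dot3 x (S *v x) = 0" "dot3 y (S *v y) = 0" "dot3 z (S *v z) = 0" "dot3 w (S *v w) = 0"
    and ns: "\<And>v. B *v v = 0 \<Longrightarrow> v = 0"
  shows "\<exists>s \<mu>. S = mscale s B + mscale \<mu> (sym_outer I J)"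
proof -
  note pair = dual_form_point_pair[OF _ nc nz I J]
  have "dot3 x (B *v y) \<noteq> 0"
  proof
    assume "dot3 x (B *v y) = 0"
    then obtain \<mu> where \<mu>: "B = mscale \<mu> (sym_outer I J)" using pair sym B by blast
    \<comment> \<open>A point pair is a singular form: it annihilates the line joining its two
      points.\<close>
    have "B *v cross I J = 0" by (simp add: \<mu>)
    moreover have "cross I J \<noteq> 0"
      using I nz by (intro nonproportional_of_line) auto
    ultimately show False using ns by blast
  qed
  define s where "s = dot3 x (S *v y) / dot3 x (B *v y)"
  have "\<exists>\<mu>. S - mscale s B = mscale \<mu> (sym_outer I J)"
    using \<open>dot3 x (B *v y) \<noteq> 0\<close> B S sym
    by (intro pair) (simp_all add: transpose_diff matrix_vector_mult_diff_rdistrib s_def)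
  then show ?thesis by (metis add.commute diff_add_cancel)
qed

section \<open>Conics with two prescribed tangents and points of contact\<close>

text \<open>\<open>S\<close> and \<open>A\<close> are the dual and the primal form of a conic touching \<open>M P\<close> and \<open>M Q\<close> at \<open>P\<close>
  and \<open>Q\<close>.\<close>

lemma dual_form_two_tangents:
  fixes S A :: "'a::field_char_0^3^3"
  assumes sym: "transpose S = S" "transpose A = A"
    and k: "k \<noteq> 0" "\<And>v. S *v (A *v v) = k *s v" "\<And>v. A *v (S *v v) = k *s v"
    and P: "dot3 P (A *v P) = 0" and Q: "dot3 Q (A *v Q) = 0" and n: "cross P Q \<noteq> 0"
  defines "M \<equiv> S *v cross P Q"
  shows "\<exists>\<beta> \<gamma>. \<beta> \<noteq> 0 \<and> S = mscale \<beta> (sym_outer M M) + mscale \<gamma> (sym_outer P Q)"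
proof -
  \<comment> \<open>\<open>n\<close> is the line \<open>P Q\<close>; \<open>u\<close> and
    \<open>v\<close> are the tangents at \<open>P\<close> and \<open>Q\<close>. Both sides are
    compared on this basis.\<close>
  define n u v where "n = cross P Q" and "u = A *v P" and "v = A *v Q"
  have nPQ: "dot3 P n = 0" "dot3 Q n = 0" "dot3 n P = 0" "dot3 n Q = 0" "n \<noteq> 0"
    using \<open>cross P Q \<noteq> 0\<close> by (simp_all add: n_def)
  have M: "M = S *v n" by (simp add: M_def n_def)
  have uv: "dot3 P u = 0" "dot3 Q v = 0" "S *v u = k *s P" "S *v v = k *s Q"
    using P Q k by (simp_all add: u_def v_def)
  have PQ_uv: "dot3 Q u = dot3 P v"
    using dot3_sym[OF sym(2)] by (simp add: u_def v_def)
  \<comment> \<open>Otherwise both tangents would be the line \<open>P Q\<close>, and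
    \<open>P\<close> and \<open>Q\<close> would both be its pole \<open>M\<close>.\<close>
  have "dot3 P v \<noteq> 0"
  proof
    assume "dot3 P v = 0"
    then obtain c d where cd: "u = c *s n" "v = d *s n"
      using orthogonal_cross[OF \<open>cross P Q \<noteq> 0\<close>] uv PQ_uv unfolding n_def by metis
    have "k *s P = c *s (S *v n)" "k *s Q = d *s (S *v n)"
      using uv by (simp_all add: cd vector_scalar_commute)
    then have "P = (c / k) *s M" "Q = (d / k) *s M"
      using k(1) by (simp_all add: M vec_eq_iff field_simps)
    then have "cross P Q = 0" by (simp add: cross_def vec_eq_iff forall_3)
    then show False using \<open>cross P Q \<noteq> 0\<close> by simp
  qed
  have "dot3 u (cross v n) = - (dot3 P v * dot3 P v)"
  proof -
    have "dot3 u (cross v n) = dot3 P u * dot3 Q v - dot3 P v * dot3 Q u"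
      by (simp add: n_def cross_def dot3_def sum_3 algebra_simps)
    then show ?thesis using uv PQ_uv by simp
  qed
  then have nc: "\<not> proj_concurrent u v n"
    using \<open>dot3 P v \<noteq> 0\<close> by (simp add: proj_concurrent_iff)
  have Mu: "dot3 M u = 0" "dot3 M v = 0"
    using dot3_sym[OF sym(1), of _ n] uv nPQ by (simp_all add: M dot3_commute[of "S *v n"])
  have "dot3 M n \<noteq> 0"
  proof
    assume "dot3 M n = 0"
    then have "M = 0" using proj_concurrent_dot3[OF nc] Mu by blast
    then have "k *s n = 0" using k(3)[of n] by (simp add: M)
    then show False using k(1) nPQ by simp
  qed
  \<comment> \<open>Forced by the values of \<open>S\<close> at the pair \<open>n\<close>,
    \<open>n\<close> and at the pair \<open>u\<close>, \<open>v\<close>.\<close>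
  define \<beta> \<gamma> where "\<beta> = 1 / (2 * dot3 M n)" and "\<gamma> = k / dot3 P v"
  define F where "F = S - mscale \<beta> (sym_outer M M) - mscale \<gamma> (sym_outer P Q)"
  have Fmv: "F *v x = S *v x - (2 * \<beta> * dot3 M x) *s M
      - \<gamma> *s (dot3 Q x *s P + dot3 P x *s Q)" for x
    by (simp add: F_def matrix_vector_mult_diff_rdistrib vec_eq_iff)
  have "F = 0"
  proof (rule symmetric_matrix_eq_0[OF _ nc])
    show "transpose F = F" by (simp add: F_def transpose_diff sym)
  qed (use \<open>dot3 M n \<noteq> 0\<close> \<open>dot3 P v \<noteq> 0\<close> uv PQ_uv nPQ Mu in
      \<open>simp_all add: Fmv \<beta>_def \<gamma>_def M[symmetric] dot3_commute[of _ M] dot3_commute[of _ P]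
        dot3_commute[of _ Q] field_simps\<close>)
  then have "S = mscale \<beta> (sym_outer M M) + mscale \<gamma> (sym_outer P Q)"
    by (simp add: F_def diff_eq_eq add.commute)
  moreover have "\<beta> \<noteq> 0" using \<open>dot3 M n \<noteq> 0\<close> by (simp add: \<beta>_def)
  ultimately show ?thesis by blast
qed

text \<open>If \<open>I\<close>, \<open>J\<close>, \<open>M\<close> lie on a line \<open>l\<close>, the primal form is \<open>l l\<^sup>T\<close>. Otherwise \<open>D\<close> is inverted in
  the basis \<open>M, I, J\<close>, whose dual basis is \<open>m, u, v\<close> up to the factor \<open>\<Delta>\<close>.\<close>

lemma conic_two_tangents:
  fixes I J M :: "'a::field_char_0^3"
  assumes nz: "\<beta> \<noteq> 0" "\<mu> \<noteq> 0" and h: "dot3 I h = 0" "dot3 J h \<noteq> 0" and I0: "I \<noteq> 0"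
  defines "D \<equiv> mscale \<beta> (sym_outer M M) - mscale \<mu> (sym_outer I J)"
  shows "\<exists>A. is_conic (A, D) \<and> dot3 I (A *v I) = 0 \<and> dot3 J (A *v J) = 0 \<and>
    (\<not> proj_collinear I J M \<longrightarrow> nondegenerate_conic (A, D))"
proof -
  have Dmv: "D *v x = (2 * \<beta> * dot3 M x) *s M - \<mu> *s (dot3 J x *s I + dot3 I x *s J)" for x
    by (simp add: D_def matrix_vector_mult_diff_rdistrib vec_eq_iff)
  have symD: "transpose D = D" by (simp add: D_def transpose_diff)
  \<comment> \<open>Test at \<open>h\<close>, a line through \<open>I\<close> but not
    \<open>J\<close>: if \<open>D\<close> were zero, \<open>M\<close> would lie on \<open>h\<close>,
    and then \<open>I\<close> would vanish.\<close>
  have D0: "D \<noteq> 0"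
  proof
    assume "D = 0"
    then have *: "(2 * \<beta> * dot3 M h) *s M = (\<mu> * dot3 J h) *s I"
      using Dmv[of h] h by (simp add: \<open>D = 0\<close>)
    have "dot3 ((2 * \<beta> * dot3 M h) *s M) h = 0" unfolding * by (simp add: h)
    then have "dot3 M h = 0" using nz by simp
    then show False using * nz h I0 by simp
  qed
  show ?thesis
  proof (cases "proj_collinear I J M")
    case True
    then obtain l where l: "l \<noteq> 0" "dot3 I l = 0" "dot3 J l = 0" "dot3 M l = 0"
      unfolding proj_collinear_def incident_dot3 by blast
    define A where "A = sym_outer l l"
    have "A *v (D *v x) = 0" for x
      using l by (simp add: A_def Dmv dot3_commute[of l])
    then have "A ** D = mat 0"
      by (simp add: matrix_eq mat_vec_scale flip: matrix_vector_mul_assoc)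
    then have "\<exists>k. A ** D = mat k" ..
    moreover have "A \<noteq> 0"
      using l(1) by (auto simp: A_def sym_outer_def vec_eq_iff)
    ultimately show ?thesis using True symD D0 l
      by (intro exI[of _ A]) (auto simp: is_conic_def A_def dot3_commute[of l])
  next
    case False
    define m u v where "m = cross I J" and "u = cross J M" and "v = cross M I"
    define \<Delta> where "\<Delta> = dot3 M m"
    \<comment> \<open>With these coefficients each of the three components of \<open>D *v x\<close>
      along \<open>M\<close>, \<open>I\<close>, \<open>J\<close> acquires the same factor
      \<open>4 * \<beta> * \<mu> * \<Delta>\<close> under \<open>A\<close>.\<close>
    define A where "A = mscale \<mu> (sym_outer m m) - mscale (4 * \<beta>) (sym_outer u v)"
    have m0: "m \<noteq> 0" using nonproportional_of_line[OF h I0] by (simp add: m_def)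
    have \<Delta>: "\<Delta> \<noteq> 0"
      using False m0 unfolding proj_collinear_def incident_dot3 \<Delta>_def m_def
      using dot3_cross(1,2) by blast
    have dual: "dot3 m M = \<Delta>" "dot3 u I = \<Delta>" "dot3 v J = \<Delta>" "dot3 m I = 0" "dot3 m J = 0"
      "dot3 u M = 0" "dot3 u J = 0" "dot3 v M = 0" "dot3 v I = 0"
      by (simp_all add: \<Delta>_def m_def u_def v_def dot3_def cross_def sum_3 algebra_simps)
    have Amv: "A *v x = (2 * \<mu> * dot3 m x) *s m
        - (4 * \<beta>) *s (dot3 v x *s u + dot3 u x *s v)" for x
      by (simp add: A_def matrix_vector_mult_diff_rdistrib vec_eq_iff)
    have expand: "dot3 M x *s m + dot3 I x *s u + dot3 J x *s v = \<Delta> *s x" for x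
      unfolding \<Delta>_def m_def u_def v_def
      by (simp add: cross_def dot3_def vec_eq_iff forall_3 sum_3) algebra
    have "A *v (D *v x) = (4 * \<beta> * \<mu> * \<Delta>) *s (dot3 M x *s m + dot3 I x *s u + dot3 J x *s v)" for x
      by (simp add: Amv Dmv dual vec_eq_iff algebra_simps)
    then have AD: "A ** D = mat (4 * \<beta> * \<mu> * \<Delta> * \<Delta>)"
      by (simp add: expand matrix_eq mat_vec_scale mult.assoc flip: matrix_vector_mul_assoc)
    have "det A * det D = det (mat (4 * \<beta> * \<mu> * \<Delta> * \<Delta>) :: 'a^3^3)"
      by (simp add: flip: AD det_mul)
    also have "\<dots> \<noteq> 0" using nz \<Delta> by (simp add: det_3 mat_def)
    finally have "det A \<noteq> 0" by auto
    moreover from this have "A \<noteq> 0" by (auto simp: det_3)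
    moreover have "transpose A = A" by (simp add: A_def transpose_diff)
    moreover have "dot3 I (A *v I) = 0" "dot3 J (A *v J) = 0"
      using dual by (simp_all add: Amv dot3_commute[of I] dot3_commute[of J])
    ultimately show ?thesis using symD D0 AD
      by (intro exI[of _ A]) (auto simp: is_conic_def nondegenerate_conic_def)
  qed
qed

section \<open>Duality between points and tangents; nondegenerate conics\<close>

text \<open>Transposing the product exchanges the two symmetric factors, so facts about points of a
  conic transfer to its tangents.\<close>

lemma is_conic_swap:
  assumes "is_conic C"
  shows "is_conic (snd C, fst C)"
proof -
  from assms obtain k where k: "fst C ** snd C = mat k"
    and s: "transpose (fst C) = fst C" "transpose (snd C) = snd C"
    unfolding is_conic_def by blast
  have "snd C ** fst C = transpose (fst C ** snd C)"
    by (simp add: matrix_transpose_mul s)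
  then have "snd C ** fst C = mat k" by (simp add: k)
  then show ?thesis using assms by (auto simp: is_conic_def)
qed

lemma tangent_at_swap: "tangent_at (snd C, fst C) l p \<longleftrightarrow> tangent_at C p l"
  by (auto simp: tangent_at_def incident_dot3 dot3_commute)

text \<open>From right to left this is the dual of \<open>tangent_at_exists\<close>, so it covers
  degenerate conics too.\<close>

lemma tangent_line_iff:
  assumes "is_conic C"
  shows "tangent_line C l \<longleftrightarrow> l \<noteq> 0 \<and> dot3 l (snd C *v l) = 0"
proof
  assume "tangent_line C l"
  then show "l \<noteq> 0 \<and> dot3 l (snd C *v l) = 0"
    by (auto simp: tangent_line_def tangent_at_def incident_dot3 dot3_commute)
next
  assume "l \<noteq> 0 \<and> dot3 l (snd C *v l) = 0"
  then have "on_conic (snd C, fst C) l" by (simp add: on_conic_def incident_dot3)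
  then show "tangent_line C l"
    using tangent_at_exists[OF is_conic_swap[OF assms]]
    by (metis tangent_at_swap tangent_line_def)
qed

lemma nondegenerate_conic_inverse:
  assumes "nondegenerate_conic C"
  obtains k where "k \<noteq> 0" "\<And>x. fst C *v (snd C *v x) = k *s x" "\<And>x. snd C *v (fst C *v x) = k *s x"
proof -
  have C: "is_conic C" and d: "det (fst C) \<noteq> 0"
    using assms by (auto simp: nondegenerate_conic_def)
  obtain k where k: "\<And>x. fst C *v (snd C *v x) = k *s x" "\<And>x. snd C *v (fst C *v x) = k *s x"
    using conic_products[OF C] by metis
  have inj: "v = 0" if "fst C *v v = 0" for v
    using that d by (metis invertible_det_nz invertible_left_inverse matrix_left_invertible_ker)
  have "k \<noteq> 0"
  proof
    assume "k = 0"
    then have "snd C *v x = 0" for x using inj k(1)[of x] by simp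
    then have "snd C = 0" by (simp add: matrix_eq)
    then show False using C by (simp add: is_conic_def)
  qed
  then show ?thesis using k that by blast
qed

text \<open>Up to a factor the primal form is the inverse of the dual form, so proportionality
  passes from one to the other.\<close>

lemma same_conic_of_dual:
  assumes X: "nondegenerate_conic X" and R: "nondegenerate_conic R"
    and SB: "snd R = mscale s (snd X)"
  shows "same_conic X R"
proof -
  obtain k where k: "k \<noteq> 0" "\<And>x. fst X *v (snd X *v x) = k *s x" "\<And>x. snd X *v (fst X *v x) = k *s x"
    by (rule nondegenerate_conic_inverse[OF X]) blast
  obtain k' where k': "k' \<noteq> 0" "\<And>x. fst R *v (snd R *v x) = k' *s x" "\<And>x. snd R *v (fst R *v x) = k' *s x"
    by (rule nondegenerate_conic_inverse[OF R]) blast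
  have s: "s \<noteq> 0"
  proof
    assume "s = 0"
    then have "snd R = 0" by (simp add: SB mscale_def vec_eq_iff)
    then show False using R by (simp add: nondegenerate_conic_def is_conic_def)
  qed
  have "k' *s (fst X *v x) = (s * k) *s (fst R *v x)" for x
  proof -
    \<comment> \<open>The triple product is evaluated by cancelling either its last two or its first
      two factors.\<close>
    have "k' *s (fst X *v x) = fst X *v (snd R *v (fst R *v x))"
      by (simp add: k' vector_scalar_commute)
    also have "\<dots> = (s * k) *s (fst R *v x)"
      by (simp add: SB k vector_scalar_commute)
    finally show ?thesis .
  qed
  then have "mscale k' (fst X) *v x = mscale (s * k) (fst R) *v x" for x by simp
  then have "mscale k' (fst X) = mscale (s * k) (fst R)" by (simp add: matrix_eq)
  then have "k' * fst X $ i $ j = s * k * fst R $ i $ j" for i j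
    by (simp add: mscale_def vec_eq_iff)
  then have "fst X $ i $ j = (s * k / k') * fst R $ i $ j" for i j
    using k'(1) by (simp add: field_simps)
  then show ?thesis unfolding same_conic_def using s k(1) k'(1)
    by (intro exI[of _ "s * k / k'"]) simp
qed

text \<open>Turns the geometric hypotheses into those of \<open>dual_pencil\<close>. The line
  \<open>h\<close> serves later to show that the constructed dual form is nonzero.\<close>

lemma nondegenerate_dual_pencil:
  fixes t :: "nat \<Rightarrow> 'a::field_char_0^3"
  assumes gp: "four_lines_general_position t" and IJ: "pair_of_intersections t I J"
    and X: "nondegenerate_conic X" and R: "nondegenerate_conic R"
    and tX: "\<forall>i\<in>{1..4}. tangent_line X (t i)" and tR: "\<forall>i\<in>{1..4}. tangent_line R (t i)"
  shows "\<exists>s \<mu>. snd R = mscale s (snd X) + mscale \<mu> (sym_outer I J)"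
    and "\<exists>h. dot3 I h = 0 \<and> dot3 J h \<noteq> 0"
proof -
  obtain i j k l where ijkl: "{i, j, k, l} = {1..4}" and I: "I \<noteq> 0" "dot3 I (t i) = 0" "dot3 I (t j) = 0"
    and J: "J \<noteq> 0" "dot3 J (t k) = 0" "dot3 J (t l) = 0"
    using IJ unfolding pair_of_intersections_def incident_dot3 by metis
  have mem: "i \<in> {1..4}" "j \<in> {1..4}" "k \<in> {1..4}" "l \<in> {1..4}" using ijkl by blast+
  \<comment> \<open>Four indices filling a four-element set are pairwise distinct.\<close>
  have "card {i, j, k, l} = 4" unfolding ijkl by simp
  then have "i \<noteq> j" "i \<noteq> k" "i \<noteq> l" "j \<noteq> k" "j \<noteq> l" "k \<noteq> l"
    by (auto simp: card_insert_if split: if_splits)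
  then have nc: "\<not> proj_concurrent (t i) (t j) (t k)" "\<not> proj_concurrent (t i) (t j) (t l)"
      "\<not> proj_concurrent (t i) (t k) (t l)"
    using gp mem unfolding four_lines_general_position_def by blast+
  have nz: "dot3 I (t k) \<noteq> 0" "dot3 J (t i) \<noteq> 0"
    using proj_concurrent_dot3[OF nc(1), of I] proj_concurrent_dot3[OF nc(3), of J] I J by auto
  have conic: "is_conic X" "is_conic R" using X R by (auto simp: nondegenerate_conic_def)
  show "\<exists>h. dot3 I h = 0 \<and> dot3 J h \<noteq> 0" using I nz by blast
  obtain \<kappa> where "\<kappa> \<noteq> 0" "\<And>x. fst X *v (snd X *v x) = \<kappa> *s x"
    by (rule nondegenerate_conic_inverse[OF X]) blast
  then have inj: "v = 0" if "snd X *v v = 0" for v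
    using that by (metis matrix_vector_mult_0_right vector_mul_eq_0)
  show "\<exists>s \<mu>. snd R = mscale s (snd X) + mscale \<mu> (sym_outer I J)"
    using tX tR mem conic inj
    by (intro dual_pencil[OF _ _ nc nz I(2,3) J(2,3)])
      (auto simp: tangent_line_iff is_conic_def)
qed

section \<open>Construction of the conic and verification of its tangents\<close>

theorem theorem5:
  fixes t :: "nat \<Rightarrow> 'a::real_normed_field^3"
    and I J P Q a b c d :: "'a^3"
    and X R :: "'a conic"
  assumes "four_lines_general_position t"
    and "pair_of_intersections t I J"
    and "nondegenerate_conic X" and "nondegenerate_conic R"
    and "\<not> same_conic X R"
    and "\<forall>i\<in>{1..4}. tangent_line X (t i)" and "\<forall>i\<in>{1..4}. tangent_line R (t i)"
    and "on_conic R P" and "on_conic R Q" and "\<not> proj_eq P Q"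
    and "tangents_through X P a b" and "tangents_through X Q c d"
  shows "\<exists>C. is_conic C \<and>
           tangent_line C a \<and> tangent_line C b \<and> tangent_line C c \<and> tangent_line C d \<and>
           on_conic C I \<and> on_conic C J \<and>
           (\<exists>M. M \<noteq> 0 \<and>
              (\<forall>l. tangent_at C I l \<or> tangent_at C J l \<or> tangent_at R P l \<or> tangent_at R Q l
                 \<longrightarrow> incident M l) \<and>
              (\<not> proj_collinear I J M \<longrightarrow> nondegenerate_conic C))"
proof -
  have IJ0: "I \<noteq> 0" "J \<noteq> 0" using assms(2) by (auto simp: pair_of_intersections_def)
  have X: "is_conic X" and R: "is_conic R"
    using assms(3,4) by (auto simp: nondegenerate_conic_def)
  have symR: "transpose (snd R) = snd R" "transpose (fst R) = fst R"
    using R by (auto simp: is_conic_def)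
  obtain k where k: "k \<noteq> 0" "\<And>x. snd R *v (fst R *v x) = k *s x" "\<And>x. fst R *v (snd R *v x) = k *s x"
    by (rule nondegenerate_conic_inverse[OF assms(4)]) blast
  have P: "P \<noteq> 0" "dot3 P (fst R *v P) = 0" and Q: "Q \<noteq> 0" "dot3 Q (fst R *v Q) = 0"
    using assms(8,9) by (auto simp: on_conic_def incident_dot3)
  have n: "cross P Q \<noteq> 0"
  proof
    assume "cross P Q = 0"
    then obtain e where e: "Q = e *s P" using cross_eq_0 P(1) by blast
    with Q(1) have "e \<noteq> 0" by auto
    with e have "P = inverse e *s Q" by simp
    then show False using assms(10) \<open>e \<noteq> 0\<close> unfolding proj_eq_def
      by (metis inverse_nonzero_iff_nonzero)
  qed
  \<comment> \<open>The pole of \<open>P Q\<close>, where the tangents to \<open>R\<close> at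
    \<open>P\<close> and \<open>Q\<close> meet.\<close>
  define M where "M = snd R *v cross P Q"
  have M0: "M \<noteq> 0"
  proof
    assume "M = 0"
    then have "k *s cross P Q = 0" using k(3)[of "cross P Q"] by (simp add: M_def)
    then show False using k(1) n by simp
  qed
  obtain s \<mu> where pencil: "snd R = mscale s (snd X) + mscale \<mu> (sym_outer I J)"
    using nondegenerate_dual_pencil(1)[OF assms(1-4,6,7)] by blast
  obtain h where h: "dot3 I h = 0" "dot3 J h \<noteq> 0"
    using nondegenerate_dual_pencil(2)[OF assms(1-4,6,7)] by blast
  \<comment> \<open>Here the distinctness of \<open>X\<close> and \<open>R\<close> enters.\<close>
  have \<mu>: "\<mu> \<noteq> 0"
  proof
    assume "\<mu> = 0"
    then have "snd R = mscale s (snd X)" using pencil by (simp add: mscale_def vec_eq_iff)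
    then show False using same_conic_of_dual assms(3,4,5) by blast
  qed
  obtain \<beta> \<gamma> where \<beta>: "\<beta> \<noteq> 0"
    and RM: "snd R = mscale \<beta> (sym_outer M M) + mscale \<gamma> (sym_outer P Q)"
    using dual_form_two_tangents[OF symR k P(2) Q(2) n] unfolding M_def by blast
  define D where "D = mscale \<beta> (sym_outer M M) - mscale \<mu> (sym_outer I J)"
  have D_X: "D = mscale s (snd X) - mscale \<gamma> (sym_outer P Q)"
    using pencil RM by (simp add: D_def algebra_simps)
  obtain A where A: "is_conic (A, D)" "dot3 I (A *v I) = 0" "dot3 J (A *v J) = 0"
    "\<not> proj_collinear I J M \<longrightarrow> nondegenerate_conic (A, D)"
    using conic_two_tangents[OF \<beta> \<mu> h IJ0(1), of M] unfolding D_def by blast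
  \<comment> \<open>On a line through \<open>P\<close> or \<open>Q\<close> the point pair term
    vanishes, so \<open>D\<close> is there a multiple of the dual form of \<open>X\<close>.\<close>
  have tangent: "tangent_line (A, D) l"
    if "tangent_line X l" "dot3 P l = 0 \<or> dot3 Q l = 0" for l
  proof -
    have "dot3 l (D *v l) = s * dot3 l (snd X *v l) - 2 * \<gamma> * dot3 P l * dot3 Q l"
      by (simp add: D_X matrix_vector_mult_diff_rdistrib dot3_commute[of l P] dot3_commute[of l Q])
    then show ?thesis
      using that by (auto simp: tangent_line_iff[OF X] tangent_line_iff[OF A(1)])
  qed
  have "proj_eq l l" for l :: "'a^3" unfolding proj_eq_def by (metis one_neq_zero vector_smult_lid)
  then have abcd: "tangent_line X a" "tangent_line X b" "tangent_line X c" "tangent_line X d"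
      "dot3 P a = 0" "dot3 P b = 0" "dot3 Q c = 0" "dot3 Q d = 0"
    using assms(11,12) unfolding tangents_through_def incident_dot3 by blast+
  have Dmv: "D *v l = (2 * \<beta> * dot3 M l) *s M - \<mu> *s (dot3 J l *s I + dot3 I l *s J)" for l
    by (simp add: D_def matrix_vector_mult_diff_rdistrib vec_eq_iff)
  \<comment> \<open>On a line through \<open>I\<close> or \<open>J\<close> one summand of the point
    pair drops out. Pairing with \<open>l\<close> then kills all multiples of the point of contact
    \<open>p\<close> and leaves the square of \<open>dot3 M l\<close>. The case \<open>e = 0\<close>
    is included, so the conic may be degenerate.\<close>
  have at_p: "dot3 M l = 0" if "dot3 p l = 0" "D *v l = e *s p"
    and "D *v l = (2 * \<beta> * dot3 M l) *s M - f *s p" for p l e f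
  proof -
    have "(2 * \<beta> * dot3 M l) *s M = (e + f) *s p"
      using that(2,3) by (simp add: algebra_simps)
    then have "dot3 ((2 * \<beta> * dot3 M l) *s M) l = (e + f) * dot3 p l"
      by (simp add: distrib_right)
    then show ?thesis using \<beta> that(1) by simp
  qed
  have at_IJ: "dot3 M l = 0" if "tangent_at (A, D) I l \<or> tangent_at (A, D) J l" for l
    using that Dmv[of l] at_p[of I l] at_p[of J l]
    by (auto simp: tangent_at_def incident_dot3)
  have at_PQ: "dot3 M l = 0" if l: "tangent_at R p l" and p: "p = P \<or> p = Q" for p l
  proof -
    obtain e where e: "l = e *s (fst R *v p)"
      using l tangent_at_nondegenerate_iff[OF assms(4)] unfolding proj_eq_def by blast
    \<comment> \<open>Reciprocity of pole and polar: \<open>M\<close> is on the polar of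
      \<open>p\<close> because \<open>p\<close> is on the polar \<open>P Q\<close> of
      \<open>M\<close>.\<close>
    have "dot3 M (fst R *v p) = dot3 p (k *s cross P Q)"
      using dot3_sym[OF symR(2), of M p] by (simp add: M_def k)
    then show ?thesis using p by (auto simp: e)
  qed
  show ?thesis
    using A tangent abcd IJ0 M0 at_IJ at_PQ
    by (intro exI[of _ "(A, D)"]) (auto simp: on_conic_def incident_dot3 intro!: exI[of _ M])
qed

end
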